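(* Let $r\ge1$, let $p_1,\dots,p_r\ge5$ be distinct primes, and let $n$ be a positive integer. With $x_i(n),y_i(n)$ as defined in the context, for every $i\in\{1,\dots,r\}$, $$x_i(n)=y_i(n)\quad\Longleftrightarrow\quad\delta_{p_i}(n)=0.$$
   Context: For $q\in\mathbb Z_{>0}$ and $x\in\mathbb Z$, $\delta_q(x)=x-q\lfloor x/q\rfloor\in\{0,\dots,q-1\}$. For a prime $p\ge5$: $a(p)=\frac{p\,\delta_6(p)-1}{6}$ and $b(p)=p-1-a(p)$ (both integers in $\{0,\dots,p-1\}$). Write $a_i=a(p_i)$, $b_i=b(p_i)$. $m(n)=\frac n3-1$ if $\delta_3(n)=0$; $m(n)=\frac{n-1}{3}$ if $\delta_3(n)=1$; $m(n)=\frac{n-5}{3}$ if $\delta_3(n)=2$. $x_i(n),y_i(n)$ are defined by: if $\delta_3(n)=0$, $x_i(n)=a_i$, $y_i(n)=\delta_{p_i}(m(n)-b_i)$; if $\delta_3(n)=1$, $x_i(n)=a_i$, $y_i(n)=\delta_{p_i}(m(n)-a_i)$; if $\delta_3(n)=2$, $x_i(n)=b_i$, $y_i(n)=\delta_{p_i}(m(n)-b_i)$. *)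

theory Defs
  imports Complex_Main "HOL-Computational_Algebra.Primes"
begin

definition delta :: "int \<Rightarrow> int \<Rightarrow> int" where
  "delta q x = x - q * \<lfloor>real_of_int x / real_of_int q\<rfloor>"

lemma delta_eq_mod: "delta q x = x mod q"
  by (simp add: delta_def floor_divide_of_int_eq minus_mult_div_eq_mod)

text \<open>The integer divisions below are exact (for \<open>a_of\<close> when \<open>p\<close> is a prime \<open>\<ge> 5\<close>);
  see the lemmas \<open>a_exact\<close> and \<open>m_exact\<close>.\<close>

definition a_of :: "int \<Rightarrow> int" where
  "a_of p = (p * delta 6 p - 1) div 6"

definition b_of :: "int \<Rightarrow> int" where
  "b_of p = p - 1 - a_of p"

text \<open>Note that \<open>m_of 2 = -1\<close>, so the values of \<open>m_of\<close> must be integers rather than naturals.\<close>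

definition m_of :: "int \<Rightarrow> int" where
  "m_of n = (if delta 3 n = 0 then n div 3 - 1
             else if delta 3 n = 1 then (n - 1) div 3
             else (n - 5) div 3)"

definition x_of :: "(nat \<Rightarrow> int) \<Rightarrow> nat \<Rightarrow> int \<Rightarrow> int" where
  "x_of p i n = (if delta 3 n = 0 then a_of (p i)
                 else if delta 3 n = 1 then a_of (p i)
                 else b_of (p i))"

definition y_of :: "(nat \<Rightarrow> int) \<Rightarrow> nat \<Rightarrow> int \<Rightarrow> int" where
  "y_of p i n = (if delta 3 n = 0 then delta (p i) (m_of n - b_of (p i))
                 else if delta 3 n = 1 then delta (p i) (m_of n - a_of (p i))
                 else delta (p i) (m_of n - b_of (p i)))"

lemma a_exact:
  assumes "prime p" and "p \<ge> 5"
  shows "6 * a_of p = p * delta 6 p - 1"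
proof -
  have "\<not> 2 dvd p" "\<not> 3 dvd p"
    using assms primes_dvd_imp_eq[of 2 p] primes_dvd_imp_eq[of 3 p] by auto
  then have "p mod 6 = 1 \<or> p mod 6 = 5" by presburger
  moreover have "6 dvd p * 1 - 1" if "p mod 6 = 1" using that by presburger
  moreover have "6 dvd p * 5 - 1" if "p mod 6 = 5" using that by presburger
  ultimately have "6 dvd p * (p mod 6) - 1" by auto
  then show ?thesis by (simp add: a_of_def delta_eq_mod)
qed

lemma m_exact:
  "delta 3 n = 0 \<Longrightarrow> 3 * m_of n = n - 3"
  "delta 3 n = 1 \<Longrightarrow> 3 * m_of n = n - 1"
  "delta 3 n = 2 \<Longrightarrow> 3 * m_of n = n - 5"
  unfolding m_of_def delta_eq_mod by (simp, presburger)+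

end

theory Submission
  imports Defs
begin

text \<open>Both \<open>x\<close> and \<open>y\<close> are reduced residues modulo \<open>p\<close>, so they agree iff \<open>p\<close> divides
  \<open>m - 2a\<close>, \<open>m - 2b\<close> or \<open>m - a - b\<close>, according to \<open>n mod 3\<close>. Since \<open>6a \<equiv> -1\<close>, \<open>6b \<equiv> -5\<close>
  and \<open>a + b \<equiv> -1\<close> modulo \<open>p\<close>, three times this number is in each case congruent to \<open>n\<close>.\<close>

text \<open>Since \<open>delta 6 p\<close> lies between 0 and 5, \<open>6 * a_of p\<close> lies
  between -1 and \<open>5 * p - 1\<close>; integrality lifts the lower bound to 0.\<close>

lemma a_of_bounds:
  assumes "prime p" "p \<ge> 5"
  shows "0 \<le> a_of p" "a_of p < p"
proof -
  have "0 \<le> delta 6 p" "delta 6 p \<le> 5"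
    using pos_mod_bound[of 6 p] by (simp_all add: delta_eq_mod)
  then have "0 \<le> p * delta 6 p" "p * delta 6 p \<le> p * 5"
    using \<open>p \<ge> 5\<close> by (auto intro: mult_left_mono)
  then show "0 \<le> a_of p" "a_of p < p"
    using a_exact[OF assms] \<open>p \<ge> 5\<close> by linarith+
qed

lemma eq_delta_iff:
  assumes "0 \<le> x" "x < q"
  shows "x = delta q z \<longleftrightarrow> q dvd z - x"
  using assms mod_eq_dvd_iff[of z q x] by (auto simp: delta_eq_mod)

text \<open>As \<open>p\<close> is a prime above 3, the factor 3 can be cancelled, so the test for
  \<open>k\<close> may be made on \<open>3 * k\<close>, which clears the denominator in
  \<open>m_of\<close>.\<close>

lemma dvd_iff_of_triple:
  fixes p k n c :: int
  assumes "prime p" "p \<ge> 5" "3 * k = n + p * c"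
  shows "p dvd k \<longleftrightarrow> p dvd n"
proof -
  have "\<not> p dvd 3"
    using \<open>p \<ge> 5\<close> zdvd_imp_le[of p 3] by auto
  then have "p dvd k \<longleftrightarrow> p dvd 3 * k"
    using \<open>prime p\<close> by (simp add: prime_dvd_mult_iff)
  also have "\<dots> \<longleftrightarrow> p dvd n"
    by (simp add: assms(3) dvd_add_left_iff)
  finally show ?thesis .
qed

lemma x_of_eq_y_of_iff:
  assumes p: "prime (p i)" "p i \<ge> 5"
  shows "x_of p i n = y_of p i n \<longleftrightarrow> delta (p i) n = 0"
proof -
  let ?q = "p i" and ?a = "a_of (p i)" and ?b = "b_of (p i)"
  note a = a_of_bounds[OF p] and six_a = a_exact[OF p]
  have b: "0 \<le> ?b" "?b < ?q"
    using a by (simp_all add: b_of_def)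
  have "delta 3 n = 0 \<or> delta 3 n = 1 \<or> delta 3 n = 2"
    unfolding delta_eq_mod by presburger
  then consider "delta 3 n = 0" | "delta 3 n = 1" | "delta 3 n = 2"
    by blast
  then have "x_of p i n = y_of p i n \<longleftrightarrow> ?q dvd n"
  proof cases
    case 1
    \<comment> \<open>The sum \<open>?a + ?b\<close> is exactly \<open>?q - 1\<close>, whence the
      multiple -3.\<close>
    have "3 * (m_of n - ?b - ?a) = n + ?q * (-3)"
      using m_exact(1)[OF 1] by (simp add: b_of_def)
    from dvd_iff_of_triple[OF p this] show ?thesis
      using 1 by (simp add: x_of_def y_of_def eq_delta_iff[OF a])
  next
    case 2
    have "3 * (m_of n - ?a - ?a) = n + ?q * (- delta 6 ?q)"
      using m_exact(2)[OF 2] six_a by simp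
    from dvd_iff_of_triple[OF p this] show ?thesis
      using 2 by (simp add: x_of_def y_of_def eq_delta_iff[OF a])
  next
    case 3
    \<comment> \<open>Here \<open>6 * ?b = ?q * (6 - delta 6 ?q) - 5\<close>, and the 5 cancels the
      one in \<open>3 * m_of n = n - 5\<close>.\<close>
    have "3 * (m_of n - ?b - ?b) = n + ?q * (delta 6 ?q - 6)"
      using m_exact(3)[OF 3] six_a by (simp add: b_of_def algebra_simps)
    from dvd_iff_of_triple[OF p this] show ?thesis
      using 3 by (simp add: x_of_def y_of_def eq_delta_iff[OF b])
  qed
  then show ?thesis
    by (simp add: delta_eq_mod dvd_eq_mod_eq_0)
qed

theorem lemma3p1:
  fixes r :: nat and p :: "nat \<Rightarrow> int" and n :: int
  assumes "r \<ge> 1"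
    and "\<forall>i\<in>{1..r}. prime (p i) \<and> p i \<ge> 5"
    and "inj_on p {1..r}"
    and "n > 0"
  shows "\<forall>i\<in>{1..r}. x_of p i n = y_of p i n \<longleftrightarrow> delta (p i) n = 0"
  using assms(2) x_of_eq_y_of_iff by blast

end
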